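(* Let $L$ be a planar lattice and let $\gamma$ be a lattice congruence of $L$. Then the quotient lattice $L/\gamma$ is also a planar lattice.
   Context: Points of $\mathbb{R}^2$ are written $u=(u_x,u_y)$, $\overline{pq}$ is the straight line segment from $p$ to $q$, and $\prec$ is the covering relation. A diagram is a finite ordered set $H$ whose elements are distinct points of $\mathbb{R}^2$ such that for each covering $p\prec q$ in $H$ we have $p_y<q_y$ and $\overline{pq}\cap H=\{p,q\}$. A diagram is planar if any two distinct covering segments are disjoint or intersect only at their endpoints. A planar lattice diagram is a planar diagram that is a lattice as an ordered set. A planar lattice is a (necessarily finite) lattice isomorphic to some planar lattice diagram. *)

theory Defs
  imports "HOL-Analysis.Analysis" "HOL-Algebra.Lattice"
begin

definition covers :: "('a, 'm) gorder_scheme \<Rightarrow> 'a \<Rightarrow> 'a \<Rightarrow> bool" where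
  "covers H p q \<longleftrightarrow> p \<in> carrier H \<and> q \<in> carrier H \<and> p \<sqsubset>\<^bsub>H\<^esub> q \<and>
     \<not> (\<exists>r\<in>carrier H. p \<sqsubset>\<^bsub>H\<^esub> r \<and> r \<sqsubset>\<^bsub>H\<^esub> q)"

text \<open>The point \<open>u\<close> of the plane has coordinates \<open>(fst u, snd u)\<close>.\<close>

definition diagram :: "(real \<times> real) gorder \<Rightarrow> bool" where
  "diagram H \<longleftrightarrow> partial_order H \<and> finite (carrier H) \<and>
     (\<forall>p q. covers H p q \<longrightarrow>
        snd p < snd q \<and> closed_segment p q \<inter> carrier H = {p, q})"

definition planar_diagram :: "(real \<times> real) gorder \<Rightarrow> bool" where
  "planar_diagram H \<longleftrightarrow> diagram H \<and>
     (\<forall>p q r s. covers H p q \<and> covers H r s \<and>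
        closed_segment p q \<noteq> closed_segment r s \<longrightarrow>
        closed_segment p q \<inter> closed_segment r s \<subseteq> {p, q} \<inter> {r, s})"

definition planar_lattice_diagram :: "(real \<times> real) gorder \<Rightarrow> bool" where
  "planar_lattice_diagram H \<longleftrightarrow> planar_diagram H \<and> lattice H"

definition lattice_iso ::
    "('a, 'm) gorder_scheme \<Rightarrow> ('b, 'n) gorder_scheme \<Rightarrow> ('a \<Rightarrow> 'b) \<Rightarrow> bool" where
  "lattice_iso L M f \<longleftrightarrow>
     bij_betw f (carrier L) (carrier M) \<and> join_pres L M f \<and> meet_pres L M f"

definition planar_lattice :: "('a, 'm) gorder_scheme \<Rightarrow> bool" where
  "planar_lattice L \<longleftrightarrow> lattice L \<and>
     (\<exists>(H :: (real \<times> real) gorder) f. planar_lattice_diagram H \<and> lattice_iso L H f)"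

definition lattice_congruence :: "('a, 'm) gorder_scheme \<Rightarrow> ('a \<times> 'a) set \<Rightarrow> bool" where
  "lattice_congruence L \<gamma> \<longleftrightarrow> equiv (carrier L) \<gamma> \<and>
     (\<forall>a b c d. (a, b) \<in> \<gamma> \<and> (c, d) \<in> \<gamma> \<longrightarrow>
        (a \<squnion>\<^bsub>L\<^esub> c, b \<squnion>\<^bsub>L\<^esub> d) \<in> \<gamma> \<and> (a \<sqinter>\<^bsub>L\<^esub> c, b \<sqinter>\<^bsub>L\<^esub> d) \<in> \<gamma>)"

text \<open>
  The order of the quotient is the one determined by its join operation
  \<open>[a] \<squnion> [b] = [a \<squnion> b]\<close>, namely \<open>A \<sqsubseteq> B\<close> iff \<open>A \<squnion> B = B\<close>. The lemmas below confirm that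
  this order is a lattice order whose joins and meets are computed on representatives.
\<close>

definition quotient_lattice ::
    "('a, 'm) gorder_scheme \<Rightarrow> ('a \<times> 'a) set \<Rightarrow> 'a set gorder" where
  "quotient_lattice L \<gamma> =
     \<lparr>carrier = carrier L // \<gamma>, eq = (=),
      le = (\<lambda>A B. \<exists>a\<in>A. \<exists>b\<in>B. \<gamma> `` {a \<squnion>\<^bsub>L\<^esub> b} = B)\<rparr>"

lemma carrier_quotient_lattice [simp]:
  "carrier (quotient_lattice L \<gamma>) = carrier L // \<gamma>"
  by (simp add: quotient_lattice_def)

lemma eq_quotient_lattice [simp]: "(.=\<^bsub>quotient_lattice L \<gamma>\<^esub>) = (=)"
  by (simp add: quotient_lattice_def)

context
  fixes L :: "('a, 'm) gorder_scheme" (structure) and \<gamma> :: "('a \<times> 'a) set"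
  assumes L: "lattice L" and cong: "lattice_congruence L \<gamma>"
begin

interpretation lattice L by (rule L)

lemma congruence_equiv: "equiv (carrier L) \<gamma>"
  using cong by (simp add: lattice_congruence_def)

lemma congruence_join: "(a, b) \<in> \<gamma> \<Longrightarrow> (c, d) \<in> \<gamma> \<Longrightarrow> (a \<squnion> c, b \<squnion> d) \<in> \<gamma>"
  using cong by (auto simp: lattice_congruence_def)

lemma congruence_meet: "(a, b) \<in> \<gamma> \<Longrightarrow> (c, d) \<in> \<gamma> \<Longrightarrow> (a \<sqinter> c, b \<sqinter> d) \<in> \<gamma>"
  using cong by (auto simp: lattice_congruence_def)

lemma congruence_refl: "a \<in> carrier L \<Longrightarrow> (a, a) \<in> \<gamma>"
  using congruence_equiv by (auto simp: equiv_def refl_on_def)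

lemma congruence_sym: "(a, b) \<in> \<gamma> \<Longrightarrow> (b, a) \<in> \<gamma>"
  using congruence_equiv by (auto simp: equiv_def sym_def)

lemma congruence_trans: "(a, b) \<in> \<gamma> \<Longrightarrow> (b, c) \<in> \<gamma> \<Longrightarrow> (a, c) \<in> \<gamma>"
  using congruence_equiv by (auto simp: equiv_def elim: transE)

lemma congruence_class_eq:
  assumes "a \<in> carrier L" "b \<in> carrier L"
  shows "\<gamma> `` {a} = \<gamma> `` {b} \<longleftrightarrow> (a, b) \<in> \<gamma>"
  by (rule eq_equiv_class_iff[OF congruence_equiv assms])

lemma quotient_lattice_le_join:
  assumes a: "a \<in> carrier L" and b: "b \<in> carrier L"
  shows "\<gamma> `` {a} \<sqsubseteq>\<^bsub>quotient_lattice L \<gamma>\<^esub> \<gamma> `` {b} \<longleftrightarrow> (a \<squnion> b, b) \<in> \<gamma>"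
proof
  assume "\<gamma> `` {a} \<sqsubseteq>\<^bsub>quotient_lattice L \<gamma>\<^esub> \<gamma> `` {b}"
  then obtain a' b' where *: "(a, a') \<in> \<gamma>" "(b, b') \<in> \<gamma>" "\<gamma> `` {a' \<squnion> b'} = \<gamma> `` {b}"
    by (auto simp: quotient_lattice_def)
  have "(b, b) \<in> \<gamma>" by (rule congruence_refl[OF b])
  then have "(a' \<squnion> b', b) \<in> \<gamma>" using *(3) congruence_sym by blast
  with congruence_join[OF *(1,2)] show "(a \<squnion> b, b) \<in> \<gamma>" by (rule congruence_trans)
next
  assume "(a \<squnion> b, b) \<in> \<gamma>"
  then have "\<gamma> `` {a \<squnion> b} = \<gamma> `` {b}" using a b by (simp add: congruence_class_eq)
  then show "\<gamma> `` {a} \<sqsubseteq>\<^bsub>quotient_lattice L \<gamma>\<^esub> \<gamma> `` {b}"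
    using congruence_refl[OF a] congruence_refl[OF b] by (auto simp: quotient_lattice_def)
qed

lemma quotient_lattice_le_meet:
  assumes a: "a \<in> carrier L" and b: "b \<in> carrier L"
  shows "\<gamma> `` {a} \<sqsubseteq>\<^bsub>quotient_lattice L \<gamma>\<^esub> \<gamma> `` {b} \<longleftrightarrow> (a \<sqinter> b, a) \<in> \<gamma>"
proof -
  have 1: "a \<sqinter> (a \<squnion> b) = a"
    using le_iff_join[of a "a \<squnion> b"] a b join_left by simp
  have 2: "(a \<sqinter> b) \<squnion> b = b"
    using le_iff_meet[of "a \<sqinter> b" b] a b meet_right by simp
  have "(a \<sqinter> b, a) \<in> \<gamma>" if "(a \<squnion> b, b) \<in> \<gamma>"
    using congruence_meet[OF congruence_refl[OF a] that] 1 congruence_sym by simp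
  moreover have "(a \<squnion> b, b) \<in> \<gamma>" if "(a \<sqinter> b, a) \<in> \<gamma>"
    using congruence_join[OF that congruence_refl[OF b]] 2 congruence_sym by simp
  ultimately show ?thesis using quotient_lattice_le_join[OF a b] by blast
qed

lemma quotient_lattice_le_mono:
  assumes "a \<in> carrier L" "b \<in> carrier L" "a \<sqsubseteq> b"
  shows "\<gamma> `` {a} \<sqsubseteq>\<^bsub>quotient_lattice L \<gamma>\<^esub> \<gamma> `` {b}"
  using assms le_iff_meet[of a b] congruence_refl by (simp add: quotient_lattice_le_join)

lemma partial_order_quotient_lattice: "partial_order (quotient_lattice L \<gamma>)"
proof (unfold_locales, simp_all)
  fix A assume "A \<in> carrier L // \<gamma>"
  then obtain a where a: "a \<in> carrier L" "A = \<gamma> `` {a}" by (rule quotientE)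
  then show "A \<sqsubseteq>\<^bsub>quotient_lattice L \<gamma>\<^esub> A" by (simp add: quotient_lattice_le_mono)
next
  fix A B assume AB: "A \<sqsubseteq>\<^bsub>quotient_lattice L \<gamma>\<^esub> B" "B \<sqsubseteq>\<^bsub>quotient_lattice L \<gamma>\<^esub> A"
    and "A \<in> carrier L // \<gamma>" "B \<in> carrier L // \<gamma>"
  then obtain a b where ab: "a \<in> carrier L" "A = \<gamma> `` {a}" "b \<in> carrier L" "B = \<gamma> `` {b}"
    by (auto elim!: quotientE)
  have "(a \<squnion> b, b) \<in> \<gamma>" "(b \<squnion> a, a) \<in> \<gamma>"
    using AB ab by (simp_all add: quotient_lattice_le_join)
  then have "(a, b) \<in> \<gamma>"
    using congruence_sym congruence_trans join_comm[of L a b] by metis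
  then show "A = B" using ab by (simp add: congruence_class_eq)
next
  fix A B C assume AB: "A \<sqsubseteq>\<^bsub>quotient_lattice L \<gamma>\<^esub> B" "B \<sqsubseteq>\<^bsub>quotient_lattice L \<gamma>\<^esub> C"
    and "A \<in> carrier L // \<gamma>" "B \<in> carrier L // \<gamma>" "C \<in> carrier L // \<gamma>"
  then obtain a b c where abc: "a \<in> carrier L" "A = \<gamma> `` {a}" "b \<in> carrier L" "B = \<gamma> `` {b}"
     "c \<in> carrier L" "C = \<gamma> `` {c}"
    by (auto elim!: quotientE)
  have 1: "(a \<squnion> b, b) \<in> \<gamma>" and 2: "(b \<squnion> c, c) \<in> \<gamma>"
    using AB abc by (simp_all add: quotient_lattice_le_join)
  have "(a \<squnion> (b \<squnion> c), a \<squnion> c) \<in> \<gamma>"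
    by (rule congruence_join[OF congruence_refl[OF abc(1)] 2])
  moreover have "((a \<squnion> b) \<squnion> c, b \<squnion> c) \<in> \<gamma>"
    by (rule congruence_join[OF 1 congruence_refl[OF abc(5)]])
  moreover have "(a \<squnion> b) \<squnion> c = a \<squnion> (b \<squnion> c)"
    using weak_join_assoc[of a b c] abc by (simp add: eq_is_equal)
  ultimately have "(a \<squnion> c, c) \<in> \<gamma>"
    using 2 congruence_sym congruence_trans by metis
  then show "A \<sqsubseteq>\<^bsub>quotient_lattice L \<gamma>\<^esub> C" using abc by (simp add: quotient_lattice_le_join)
qed

lemma least_quotient_lattice:
  assumes a: "a \<in> carrier L" and b: "b \<in> carrier L"
  shows "least (quotient_lattice L \<gamma>) (\<gamma> `` {a \<squnion> b})
           (Upper (quotient_lattice L \<gamma>) {\<gamma> `` {a}, \<gamma> `` {b}})"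
proof -
  interpret Q: partial_order "quotient_lattice L \<gamma>" by (rule partial_order_quotient_lattice)
  show ?thesis
  proof (rule least_UpperI)
    fix X assume "X \<in> {\<gamma> `` {a}, \<gamma> `` {b}}"
    then show "X \<sqsubseteq>\<^bsub>quotient_lattice L \<gamma>\<^esub> \<gamma> `` {a \<squnion> b}"
      using a b by (auto intro!: quotient_lattice_le_mono join_left join_right)
  next
    fix C assume C: "C \<in> Upper (quotient_lattice L \<gamma>) {\<gamma> `` {a}, \<gamma> `` {b}}"
    then have "C \<in> carrier L // \<gamma>" by (simp add: Upper_def)
    then obtain c where c: "c \<in> carrier L" "C = \<gamma> `` {c}" by (rule quotientE)
    have "\<gamma> `` {a} \<sqsubseteq>\<^bsub>quotient_lattice L \<gamma>\<^esub> C" "\<gamma> `` {b} \<sqsubseteq>\<^bsub>quotient_lattice L \<gamma>\<^esub> C"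
      using C a b by (simp_all add: Upper_def quotientI)
    then have 1: "(a \<squnion> c, c) \<in> \<gamma>" and 2: "(b \<squnion> c, c) \<in> \<gamma>"
      using a b c by (simp_all add: quotient_lattice_le_join)
    have "(a \<squnion> (b \<squnion> c), a \<squnion> c) \<in> \<gamma>"
      by (rule congruence_join[OF congruence_refl[OF a] 2])
    then have "(a \<squnion> (b \<squnion> c), c) \<in> \<gamma>" using 1 by (rule congruence_trans)
    moreover have "(a \<squnion> b) \<squnion> c = a \<squnion> (b \<squnion> c)"
      using weak_join_assoc[of a b c] a b c by (simp add: eq_is_equal)
    ultimately have "((a \<squnion> b) \<squnion> c, c) \<in> \<gamma>" by simp
    then show "\<gamma> `` {a \<squnion> b} \<sqsubseteq>\<^bsub>quotient_lattice L \<gamma>\<^esub> C"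
      using a b c by (simp add: quotient_lattice_le_join)
  qed (use a b in \<open>simp_all add: quotientI\<close>)
qed

lemma greatest_quotient_lattice:
  assumes a: "a \<in> carrier L" and b: "b \<in> carrier L"
  shows "greatest (quotient_lattice L \<gamma>) (\<gamma> `` {a \<sqinter> b})
           (Lower (quotient_lattice L \<gamma>) {\<gamma> `` {a}, \<gamma> `` {b}})"
proof -
  interpret Q: partial_order "quotient_lattice L \<gamma>" by (rule partial_order_quotient_lattice)
  show ?thesis
  proof (rule greatest_LowerI)
    fix X assume "X \<in> {\<gamma> `` {a}, \<gamma> `` {b}}"
    then show "\<gamma> `` {a \<sqinter> b} \<sqsubseteq>\<^bsub>quotient_lattice L \<gamma>\<^esub> X"
      using a b by (auto intro!: quotient_lattice_le_mono meet_left meet_right)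
  next
    fix C assume C: "C \<in> Lower (quotient_lattice L \<gamma>) {\<gamma> `` {a}, \<gamma> `` {b}}"
    then have "C \<in> carrier L // \<gamma>" by (simp add: Lower_def)
    then obtain c where c: "c \<in> carrier L" "C = \<gamma> `` {c}" by (rule quotientE)
    have "C \<sqsubseteq>\<^bsub>quotient_lattice L \<gamma>\<^esub> \<gamma> `` {a}" "C \<sqsubseteq>\<^bsub>quotient_lattice L \<gamma>\<^esub> \<gamma> `` {b}"
      using C a b by (simp_all add: Lower_def quotientI)
    then have 1: "(c \<sqinter> a, c) \<in> \<gamma>" and 2: "(c \<sqinter> b, c) \<in> \<gamma>"
      using a b c by (simp_all add: quotient_lattice_le_meet)
    have "((c \<sqinter> a) \<sqinter> b, c \<sqinter> b) \<in> \<gamma>"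
      by (rule congruence_meet[OF 1 congruence_refl[OF b]])
    then have "((c \<sqinter> a) \<sqinter> b, c) \<in> \<gamma>" using 2 by (rule congruence_trans)
    moreover have "(c \<sqinter> a) \<sqinter> b = c \<sqinter> (a \<sqinter> b)"
      using weak_meet_assoc[of c a b] a b c by (simp add: eq_is_equal)
    ultimately have "(c \<sqinter> (a \<sqinter> b), c) \<in> \<gamma>" by simp
    then show "C \<sqsubseteq>\<^bsub>quotient_lattice L \<gamma>\<^esub> \<gamma> `` {a \<sqinter> b}"
      using a b c by (simp add: quotient_lattice_le_meet)
  qed (use a b in \<open>simp_all add: quotientI\<close>)
qed

lemma lattice_quotient_lattice: "lattice (quotient_lattice L \<gamma>)"
proof -
  interpret Q: partial_order "quotient_lattice L \<gamma>" by (rule partial_order_quotient_lattice)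
  show ?thesis
  proof (unfold_locales, goal_cases)
    case (1 A B)
    then show ?case by (auto elim!: quotientE intro: least_quotient_lattice)
  next
    case (2 A B)
    then show ?case by (auto elim!: quotientE intro: greatest_quotient_lattice)
  qed
qed

lemma join_quotient_lattice:
  assumes a: "a \<in> carrier L" and b: "b \<in> carrier L"
  shows "\<gamma> `` {a} \<squnion>\<^bsub>quotient_lattice L \<gamma>\<^esub> \<gamma> `` {b} = \<gamma> `` {a \<squnion> b}"
proof -
  interpret Q: lattice "quotient_lattice L \<gamma>" by (rule lattice_quotient_lattice)
  show ?thesis
  proof (rule Q.joinI)
    fix C assume "least (quotient_lattice L \<gamma>) C (Upper (quotient_lattice L \<gamma>) {\<gamma> `` {a}, \<gamma> `` {b}})"
    then show "C = \<gamma> `` {a \<squnion> b}"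
      by (rule Q.least_unique[OF _ least_quotient_lattice[OF a b]])
  qed (use a b in \<open>simp_all add: quotientI\<close>)
qed

lemma meet_quotient_lattice:
  assumes a: "a \<in> carrier L" and b: "b \<in> carrier L"
  shows "\<gamma> `` {a} \<sqinter>\<^bsub>quotient_lattice L \<gamma>\<^esub> \<gamma> `` {b} = \<gamma> `` {a \<sqinter> b}"
proof -
  interpret Q: lattice "quotient_lattice L \<gamma>" by (rule lattice_quotient_lattice)
  show ?thesis
  proof (rule Q.meetI)
    fix C assume "greatest (quotient_lattice L \<gamma>) C (Lower (quotient_lattice L \<gamma>) {\<gamma> `` {a}, \<gamma> `` {b}})"
    then show "C = \<gamma> `` {a \<sqinter> b}"
      by (rule Q.greatest_unique[OF _ greatest_quotient_lattice[OF a b]])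
  qed (use a b in \<open>simp_all add: quotientI\<close>)
qed

end

end

theory Submission
  imports Defs
begin

text \<open>
  For a finite lattice, planarity is equivalent to order dimension at most two, and the latter is
  inherited by subsets: \<open>L/\<gamma>\<close> embeds into \<open>L\<close> as an ordered set, each class being sent to its
  least element.

  If the order is the product order of coordinates \<open>(X, Y)\<close>, then drawing \<open>a\<close> at \<open>(X a, Y a)\<close>
  works: if the covering segments of \<open>p \<prec> q\<close> and \<open>r \<prec> s\<close> share a point, then \<open>p, r \<le> q, s\<close>,
  so the join of \<open>p\<close> and \<open>r\<close> lies in both covering intervals and is an end of both.

  Conversely, in a planar lattice diagram say that \<open>a\<close> is left of an incomparable \<open>b\<close> if it lies to
  the left of a maximal chain through \<open>b\<close>. Chains are graphs over the vertical axis and meet only in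
  common elements, so the intermediate value theorem shows that the choice of the chain is irrelevant
  and that this relation is a strict order on the incomparable pairs. Adding it, or its converse, to
  the order yields two linear extensions whose intersection is the order.
\<close>

section \<open>Lattices of order dimension two are planar\<close>

text \<open>Only \<open>Y\<close> has to be injective: it becomes the height in the diagram, which
  must increase strictly along coverings. Ties in \<open>X\<close> are harmless.\<close>

definition two_dimensional :: "('a, 'm) gorder_scheme \<Rightarrow> bool" where
  "two_dimensional L \<longleftrightarrow> (\<exists>(X :: 'a \<Rightarrow> real) (Y :: 'a \<Rightarrow> real). inj_on Y (carrier L) \<and>
     (\<forall>a\<in>carrier L. \<forall>b\<in>carrier L. a \<sqsubseteq>\<^bsub>L\<^esub> b \<longleftrightarrow> X a \<le> X b \<and> Y a \<le> Y b))"

lemma two_dimensional_embedding: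
  assumes L: "two_dimensional L"
    and e: "inj_on e (carrier Q)" "e \<in> carrier Q \<rightarrow> carrier L"
      "\<And>a b. a \<in> carrier Q \<Longrightarrow> b \<in> carrier Q \<Longrightarrow> a \<sqsubseteq>\<^bsub>Q\<^esub> b \<longleftrightarrow> e a \<sqsubseteq>\<^bsub>L\<^esub> e b"
  shows "two_dimensional Q"
proof -
  obtain X Y :: "_ \<Rightarrow> real" where Y: "inj_on Y (carrier L)"
    and le: "\<And>a b. a \<in> carrier L \<Longrightarrow> b \<in> carrier L \<Longrightarrow> a \<sqsubseteq>\<^bsub>L\<^esub> b \<longleftrightarrow> X a \<le> X b \<and> Y a \<le> Y b"
    using L unfolding two_dimensional_def by blast
  have "inj_on (Y \<circ> e) (carrier Q)"
    using e(1,2) Y by (auto simp: inj_on_def Pi_iff)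
  moreover have "a \<sqsubseteq>\<^bsub>Q\<^esub> b \<longleftrightarrow> (X \<circ> e) a \<le> (X \<circ> e) b \<and> (Y \<circ> e) a \<le> (Y \<circ> e) b"
    if "a \<in> carrier Q" "b \<in> carrier Q" for a b
    using that e le[of "e a" "e b"] by (auto simp: Pi_iff)
  ultimately show ?thesis unfolding two_dimensional_def by blast
qed

lemma lattice_iso_le_iff:
  assumes "lattice_iso L M f" "a \<in> carrier L" "b \<in> carrier L"
  shows "a \<sqsubseteq>\<^bsub>L\<^esub> b \<longleftrightarrow> f a \<sqsubseteq>\<^bsub>M\<^esub> f b"
proof -
  have bij: "bij_betw f (carrier L) (carrier M)" and j: "join_pres L M f"
    using assms(1) by (auto simp: lattice_iso_def)
  interpret L: lattice L using j by (simp add: join_pres_def)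
  interpret M: lattice M using j by (simp add: join_pres_def)
  have "f (a \<squnion>\<^bsub>L\<^esub> b) = f a \<squnion>\<^bsub>M\<^esub> f b" using j assms(2,3) by (simp add: join_pres_def)
  moreover have "f (a \<squnion>\<^bsub>L\<^esub> b) = f b \<longleftrightarrow> a \<squnion>\<^bsub>L\<^esub> b = b"
    using bij assms(2,3) by (auto simp: bij_betw_def inj_on_def)
  moreover have "f a \<in> carrier M" "f b \<in> carrier M" using bij assms(2,3) by (auto dest: bij_betwE)
  ultimately show ?thesis using assms(2,3) by (simp add: L.le_iff_meet M.le_iff_meet)
qed

text \<open>Joins and meets are determined by the order, so \<open>f\<close> carries them over. That
  \<open>M\<close> is a lattice is a conclusion: the diagram built below is at first only an ordered
  set.\<close>

lemma lattice_iso_of_order_iso: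
  assumes L: "lattice L" and M: "partial_order M" and bij: "bij_betw f (carrier L) (carrier M)"
    and le: "\<And>a b. a \<in> carrier L \<Longrightarrow> b \<in> carrier L \<Longrightarrow> a \<sqsubseteq>\<^bsub>L\<^esub> b \<longleftrightarrow> f a \<sqsubseteq>\<^bsub>M\<^esub> f b"
  shows "lattice M" "lattice_iso L M f"
proof -
  interpret L: lattice L by (rule L)
  interpret M: partial_order M by (rule M)
  have car: "f a \<in> carrier M" if "a \<in> carrier L" for a using bij that by (auto dest: bij_betwE)
  have surj: "\<exists>a\<in>carrier L. p = f a" if "p \<in> carrier M" for p
    using bij that by (auto simp: bij_betw_def)
  have lub: "least M (f (a \<squnion>\<^bsub>L\<^esub> b)) (Upper M {f a, f b})" if "a \<in> carrier L" "b \<in> carrier L" for a b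
  proof (rule least_UpperI)
    fix p assume p: "p \<in> Upper M {f a, f b}"
    then obtain c where c: "c \<in> carrier L" "p = f c" using surj[of p] by (auto simp: Upper_def)
    then have "a \<sqsubseteq>\<^bsub>L\<^esub> c" "b \<sqsubseteq>\<^bsub>L\<^esub> c" using p that car by (auto simp: Upper_def le)
    then show "f (a \<squnion>\<^bsub>L\<^esub> b) \<sqsubseteq>\<^bsub>M\<^esub> p" using c that le[of "a \<squnion>\<^bsub>L\<^esub> b" c] by (simp add: L.join_le)
  next
    fix p assume "p \<in> {f a, f b}"
    then show "p \<sqsubseteq>\<^bsub>M\<^esub> f (a \<squnion>\<^bsub>L\<^esub> b)"
      using that le[of a "a \<squnion>\<^bsub>L\<^esub> b"] le[of b "a \<squnion>\<^bsub>L\<^esub> b"] L.join_left L.join_right by auto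
  qed (use that car in auto)
  have glb: "greatest M (f (a \<sqinter>\<^bsub>L\<^esub> b)) (Lower M {f a, f b})" if "a \<in> carrier L" "b \<in> carrier L" for a b
  proof (rule greatest_LowerI)
    fix p assume p: "p \<in> Lower M {f a, f b}"
    then obtain c where c: "c \<in> carrier L" "p = f c" using surj[of p] by (auto simp: Lower_def)
    then have "c \<sqsubseteq>\<^bsub>L\<^esub> a" "c \<sqsubseteq>\<^bsub>L\<^esub> b" using p that car by (auto simp: Lower_def le)
    then show "p \<sqsubseteq>\<^bsub>M\<^esub> f (a \<sqinter>\<^bsub>L\<^esub> b)" using c that le[of c "a \<sqinter>\<^bsub>L\<^esub> b"] by (simp add: L.meet_le)
  next
    fix p assume "p \<in> {f a, f b}"
    then show "f (a \<sqinter>\<^bsub>L\<^esub> b) \<sqsubseteq>\<^bsub>M\<^esub> p"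
      using that le[of "a \<sqinter>\<^bsub>L\<^esub> b" a] le[of "a \<sqinter>\<^bsub>L\<^esub> b" b] L.meet_left L.meet_right by auto
  qed (use that car in auto)
  interpret M: lattice M
  proof (unfold_locales, goal_cases)
    case (1 x y)
    then show ?case using lub surj by metis
  next
    case (2 x y)
    then show ?case using glb surj by metis
  qed
  show "lattice M" ..
  have "f (a \<squnion>\<^bsub>L\<^esub> b) = f a \<squnion>\<^bsub>M\<^esub> f b" if "a \<in> carrier L" "b \<in> carrier L" for a b
    using M.joinI[of "f a" "f b" "\<lambda>s. f (a \<squnion>\<^bsub>L\<^esub> b) = s"] lub[OF that] M.least_unique that car by metis
  moreover have "f (a \<sqinter>\<^bsub>L\<^esub> b) = f a \<sqinter>\<^bsub>M\<^esub> f b" if "a \<in> carrier L" "b \<in> carrier L" for a b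
    using M.meetI[of "f a" "f b" "\<lambda>s. f (a \<sqinter>\<^bsub>L\<^esub> b) = s"] glb[OF that] M.greatest_unique that car by metis
  ultimately show "lattice_iso L M f"
    using L bij M.lattice_axioms by (auto simp: lattice_iso_def join_pres_def meet_pres_def)
qed

text \<open>The order on points is componentwise, and the box \<open>{p..q}\<close> is
  convex.\<close>

lemma closed_segment_coordinates_le:
  fixes p q z :: "real \<times> real"
  assumes "z \<in> closed_segment p q" "p \<le> q"
  shows "p \<le> z" "z \<le> q"
proof -
  have "z \<in> {p..q}"
    using assms closed_segment_subset[of p "{p..q}" q] convex_closed_interval by auto
  then show "p \<le> z" "z \<le> q" by auto
qed

text \<open>Both segments lie on the ray from \<open>p\<close> through \<open>z\<close>, so the
  shorter one ends on the longer one.\<close>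

lemma closed_segments_common_endpoint:
  fixes p q s z :: "'a::real_vector"
  assumes "z \<in> closed_segment p q" "z \<in> closed_segment p s" "z \<noteq> p"
  shows "s \<in> closed_segment p q \<or> q \<in> closed_segment p s"
proof -
  have aux: "b \<in> closed_segment p a"
    if "t *\<^sub>R (a - p) = u *\<^sub>R (b - p)" "0 \<le> t" "t \<le> u" "0 < u" for t u :: real and a b
  proof -
    have "b - p = (1 / u) *\<^sub>R (u *\<^sub>R (b - p))" using \<open>0 < u\<close> by simp
    also have "\<dots> = (t / u) *\<^sub>R (a - p)" using that(1)[symmetric] by simp
    finally have "b = (1 - t / u) *\<^sub>R p + (t / u) *\<^sub>R a" by (simp add: algebra_simps)
    then show ?thesis using that(2-4) unfolding in_segment by (intro exI[of _ "t / u"]) auto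
  qed
  obtain t u where tu: "0 \<le> t" "0 \<le> u" "z = (1 - t) *\<^sub>R p + t *\<^sub>R q" "z = (1 - u) *\<^sub>R p + u *\<^sub>R s"
    using assms(1,2) unfolding in_segment by auto
  have "t *\<^sub>R (q - p) = z - p" "u *\<^sub>R (s - p) = z - p"
    by (simp add: tu(3) algebra_simps) (simp add: tu(4) algebra_simps)
  moreover have "t \<noteq> 0" "u \<noteq> 0" using tu assms(3) by auto
  ultimately show ?thesis using aux[of t q u s] aux[of u s t q] tu(1,2) by (cases "t \<le> u") auto
qed

lemma planar_lattice_of_two_dimensional:
  assumes L: "lattice L" and fin: "finite (carrier L)" and dim: "two_dimensional L"
  shows "planar_lattice L"
proof -
  interpret L: lattice L by (rule L)
  obtain X Y :: "_ \<Rightarrow> real" where Y: "inj_on Y (carrier L)"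
    and XY: "\<And>a b. a \<in> carrier L \<Longrightarrow> b \<in> carrier L \<Longrightarrow> a \<sqsubseteq>\<^bsub>L\<^esub> b \<longleftrightarrow> X a \<le> X b \<and> Y a \<le> Y b"
    using dim unfolding two_dimensional_def by blast
  define f where "f a = (X a, Y a)" for a
  define H :: "(real \<times> real) gorder" where "H = \<lparr>carrier = f ` carrier L, eq = (=), le = (\<le>)\<rparr>"
  have carH: "carrier H = f ` carrier L" and leH: "p \<sqsubseteq>\<^bsub>H\<^esub> q \<longleftrightarrow> p \<le> q" and eqH: "(.=\<^bsub>H\<^esub>) = (=)" for p q
    by (simp_all add: H_def)
  interpret H: partial_order H by unfold_locales (auto simp: leH eqH)
  have bij: "bij_betw f (carrier L) (carrier H)"
    using Y by (simp add: bij_betw_def carH) (simp add: f_def inj_on_def)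
  have le: "a \<sqsubseteq>\<^bsub>L\<^esub> b \<longleftrightarrow> f a \<sqsubseteq>\<^bsub>H\<^esub> f b" if "a \<in> carrier L" "b \<in> carrier L" for a b
    using XY[OF that] by (simp add: leH f_def)
  note iso = lattice_iso_of_order_iso[OF L H.partial_order_axioms bij le]
  interpret H: lattice H using iso(1) by simp
  have cov: "p \<in> carrier H" "q \<in> carrier H" "p < q"
    "\<And>r. r \<in> carrier H \<Longrightarrow> p \<le> r \<Longrightarrow> r \<le> q \<Longrightarrow> r = p \<or> r = q" if "covers H p q" for p q
    using that unfolding covers_def H.lless_eq leH by (auto simp: less_le)
  have "snd p < snd q" if pq: "covers H p q" for p q
  proof -
    obtain a b where "a \<in> carrier L" "p = f a" "b \<in> carrier L" "q = f b"
      using cov(1,2)[OF pq] carH by auto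
    then show ?thesis using cov(3)[OF pq] Y by (auto simp: f_def less_le inj_on_def)
  qed
  moreover have "closed_segment p q \<inter> carrier H = {p, q}" if pq: "covers H p q" for p q
  proof -
    have "z = p \<or> z = q" if "z \<in> closed_segment p q" "z \<in> carrier H" for z
      using closed_segment_coordinates_le[OF that(1)] cov(3)[OF pq] cov(4)[OF pq that(2)] by simp
    then show ?thesis using cov(1,2)[OF pq] by blast
  qed
  ultimately have diagram: "diagram H"
    using fin by (auto simp: diagram_def carH H.partial_order_axioms)
  have "z \<in> {p, q} \<inter> {r, s}"
    if pq: "covers H p q" and rs: "covers H r s" and ne: "closed_segment p q \<noteq> closed_segment r s"
      and z: "z \<in> closed_segment p q" "z \<in> closed_segment r s" for p q r s z
  proof -
    note [simp] = cov(1,2)[OF pq] cov(1,2)[OF rs]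
    have pz: "p \<le> z" "z \<le> q" using closed_segment_coordinates_le z(1) cov(3)[OF pq] by auto
    have rz: "r \<le> z" "z \<le> s" using closed_segment_coordinates_le z(2) cov(3)[OF rs] by auto
    define j where "j = p \<squnion>\<^bsub>H\<^esub> r"
    have j: "j \<in> carrier H" "p \<le> j" "r \<le> j" "j \<le> q" "j \<le> s"
      using H.join_left[of p r] H.join_right[of p r] H.join_le[of p q r] H.join_le[of p s r] pz rz
      by (auto simp: j_def leH)
    then have jpq: "j = p \<or> j = q" and jrs: "j = r \<or> j = s"
      using cov(4)[OF pq] cov(4)[OF rs] by auto
    \<comment> \<open>Since \<open>j\<close> is an end of both intervals, four coincidences of ends
      remain. If both segments start at \<open>p\<close>, a further common point puts
      \<open>q\<close> or \<open>s\<close> on the other segment, hence in the other covering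
      interval; this forces \<open>q = s\<close> and equal segments, against
      \<open>ne\<close>.\<close>
    have "z = p" if "p = r"
    proof (rule ccontr)
      assume "z \<noteq> p"
      then have "s \<in> closed_segment p q \<or> q \<in> closed_segment p s"
        using closed_segments_common_endpoint z that by blast
      then have "s = p \<or> s = q \<or> q = p"
        using closed_segment_coordinates_le[of s p q] closed_segment_coordinates_le[of q p s]
          cov(3)[OF pq, THEN less_imp_le] cov(3)[OF rs, THEN less_imp_le] cov(4)[OF pq, of s] cov(4)[OF rs, of q]
        unfolding that by auto
      then show False using cov(3)[OF pq] cov(3)[OF rs] ne that by auto
    qed
    moreover have "z = q" if "q = s"
    proof (rule ccontr)
      assume "z \<noteq> q"
      then have "r \<in> closed_segment p q \<or> p \<in> closed_segment r q"
        using closed_segments_common_endpoint[of z q p r] z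
        unfolding that[symmetric] closed_segment_commute[of q p] closed_segment_commute[of q r] by blast
      then have "r = p \<or> r = q \<or> p = q"
        using closed_segment_coordinates_le[of r p q] closed_segment_coordinates_le[of p r q]
          cov(3)[OF pq, THEN less_imp_le] cov(3)[OF rs, THEN less_imp_le] cov(4)[OF pq, of r] cov(4)[OF rs, of p]
        unfolding that by auto
      then show False using cov(3)[OF pq] cov(3)[OF rs] ne that by auto
    qed
    moreover have "z = p" if "p = s" using that pz(1) rz(2) order_antisym[of z p] by simp
    moreover have "z = q" if "q = r" using that pz(2) rz(1) order_antisym[of z q] by simp
    moreover have "p = r \<or> p = s \<or> q = r \<or> q = s" using jpq jrs by blast
    ultimately show ?thesis by blast
  qed
  then have "planar_lattice_diagram H"
    using diagram H.lattice_axioms unfolding planar_lattice_diagram_def planar_diagram_def by blast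
  then show ?thesis using L iso(2) unfolding planar_lattice_def by blast
qed

text \<open>The rank of \<open>a\<close> is the number of elements below it. If \<open>R a b\<close>
  fails, then \<open>D b\<close> is a proper subset of \<open>D a\<close>, since \<open>a\<close>
  itself is missing from it.\<close>

lemma linear_extension_rank:
  fixes R :: "'a \<Rightarrow> 'a \<Rightarrow> bool"
  assumes "finite A"
    and tot: "\<And>a b. a \<in> A \<Longrightarrow> b \<in> A \<Longrightarrow> R a b \<or> R b a"
    and trans: "\<And>a b c. a \<in> A \<Longrightarrow> b \<in> A \<Longrightarrow> c \<in> A \<Longrightarrow> R a b \<Longrightarrow> R b c \<Longrightarrow> R a c"
  shows "\<exists>X :: 'a \<Rightarrow> real. \<forall>a\<in>A. \<forall>b\<in>A. R a b \<longleftrightarrow> X a \<le> X b"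
proof -
  define D where "D a = {c \<in> A. R c a}" for a
  have "R a b \<longleftrightarrow> card (D a) \<le> card (D b)" if "a \<in> A" "b \<in> A" for a b
  proof
    assume "R a b"
    then have "D a \<subseteq> D b" unfolding D_def using that trans by blast
    then show "card (D a) \<le> card (D b)" using \<open>finite A\<close> by (auto intro: card_mono simp: D_def)
  next
    assume le: "card (D a) \<le> card (D b)"
    show "R a b"
    proof (rule ccontr)
      assume n: "\<not> R a b"
      then have "R b a" using tot that by blast
      then have "D b \<subset> D a" unfolding D_def using that trans n tot[of a a] by blast
      then have "card (D b) < card (D a)" using \<open>finite A\<close> by (auto intro: psubset_card_mono simp: D_def)
      with le show False by simp
    qed
  qed
  then show ?thesis by (intro exI[of _ "\<lambda>a. real (card (D a))"]) auto
qed

section \<open>Planar lattices have order dimension two\<close>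

lemma graphs_cross:
  fixes f g :: "real \<Rightarrow> real"
  assumes "continuous_on {s..t} f" "continuous_on {s..t} g" "s \<le> t"
    and "f s < g s \<and> g t < f t \<or> g s < f s \<and> f t < g t"
  shows "\<exists>h\<in>{s..t}. f h = g h"
proof -
  have "continuous_on {s..t} (\<lambda>h. f h - g h)" using assms by (intro continuous_intros)
  then obtain h where "h \<in> {s..t}" "f h - g h = 0"
    using assms IVT'[of "\<lambda>h. f h - g h" s 0 t] IVT2'[of "\<lambda>h. f h - g h" t 0 s] by auto
  then show ?thesis by auto
qed

text \<open>With fixed bounds every maximal chain runs from \<open>zero\<close> to
  \<open>one\<close>, so all chains are graphs over the same range of heights.\<close>

locale bounded_planar_diagram = lattice H
  for H :: "(real \<times> real) gorder" (structure) and zero one :: "real \<times> real" +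
  assumes planar: "planar_diagram H"
    and zero: "zero \<in> carrier H" "\<And>x. x \<in> carrier H \<Longrightarrow> zero \<sqsubseteq> x"
    and one: "one \<in> carrier H" "\<And>x. x \<in> carrier H \<Longrightarrow> x \<sqsubseteq> one"
begin

lemma finite_carrier: "finite (carrier H)"
  using planar by (simp add: planar_diagram_def diagram_def)

lemma antisymmetric: "x \<sqsubseteq> y \<Longrightarrow> y \<sqsubseteq> x \<Longrightarrow> x \<in> carrier H \<Longrightarrow> y \<in> carrier H \<Longrightarrow> x = y"
  using weak_le_antisym[of x y] by (simp add: eq_is_equal)

lemma coversD:
  assumes "covers H p q"
  shows "p \<in> carrier H" "q \<in> carrier H" "p \<sqsubseteq> q" "snd p < snd q"
    "closed_segment p q \<inter> carrier H = {p, q}"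
  using assms planar unfolding covers_def lless_def planar_diagram_def diagram_def by blast+

text \<open>Induction on the size of the interval: if it is neither trivial nor a covering, an inner
  element \<open>r\<close> splits it into two parts, each missing one end. This replaces explicit
  lists of covering steps.\<close>

lemma interval_induct [consumes 3, case_names refl cover split]:
  assumes "u \<sqsubseteq> v" "u \<in> carrier H" "v \<in> carrier H"
    and refl: "\<And>u. u \<in> carrier H \<Longrightarrow> P u u"
    and cover: "\<And>u v. covers H u v \<Longrightarrow> P u v"
    and split: "\<And>u r v. u \<in> carrier H \<Longrightarrow> r \<in> carrier H \<Longrightarrow> v \<in> carrier H \<Longrightarrow>
      u \<sqsubseteq> r \<Longrightarrow> r \<sqsubseteq> v \<Longrightarrow> P u r \<Longrightarrow> P r v \<Longrightarrow> P u v"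
  shows "P u v"
proof -
  define I where "I u v = {x \<in> carrier H. u \<sqsubseteq> x \<and> x \<sqsubseteq> v}" for u v
  have fin: "finite (I u v)" for u v using finite_carrier by (simp add: I_def)
  show ?thesis using assms(1-3)
  proof (induction "card (I u v)" arbitrary: u v rule: less_induct)
    case less
    note uv = less.prems
    show ?case
    proof (cases "u = v \<or> covers H u v")
      case True
      then show ?thesis using refl cover uv by blast
    next
      case False
      then obtain r where r: "r \<in> carrier H" "u \<sqsubseteq> r" "r \<sqsubseteq> v" "u \<noteq> r" "r \<noteq> v"
        using uv by (auto simp: covers_def lless_eq)
      have "v \<notin> I u r" "u \<notin> I r v" using r uv antisymmetric by (auto simp: I_def)
      moreover have "I u r \<subseteq> I u v" "I r v \<subseteq> I u v" "u \<in> I u v" "v \<in> I u v"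
        unfolding I_def using r uv le_trans by blast+
      ultimately have "card (I u r) < card (I u v)" "card (I r v) < card (I u v)"
        using fin by (blast intro: psubset_card_mono)+
      then show ?thesis using less.hyps split r uv by blast
    qed
  qed
qed

lemma snd_mono: "u \<sqsubseteq> v \<Longrightarrow> u \<in> carrier H \<Longrightarrow> v \<in> carrier H \<Longrightarrow> snd u \<le> snd v"
proof (induction u v rule: interval_induct)
  case (cover u v)
  then show ?case using coversD(4)[of u v] by simp
qed auto

text \<open>A maximal chain from \<open>u\<close> to \<open>v\<close> is encoded by the abscissa \<open>f h\<close> of its point at height \<open>h\<close>;
  the case \<open>p = q\<close> is needed for \<open>u = v\<close>.\<close>

definition chain_graph :: "real \<times> real \<Rightarrow> real \<times> real \<Rightarrow> (real \<Rightarrow> real) \<Rightarrow> bool" where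
  "chain_graph u v f \<longleftrightarrow> continuous_on {snd u..snd v} f \<and> f (snd u) = fst u \<and> f (snd v) = fst v \<and>
     (\<forall>h\<in>{snd u..snd v}. \<exists>p\<in>carrier H. \<exists>q\<in>carrier H. u \<sqsubseteq> p \<and> q \<sqsubseteq> v \<and> (p = q \<or> covers H p q) \<and>
        (f h, h) \<in> closed_segment p q)"

lemma chain_graph_cong:
  assumes "chain_graph u v f" "\<And>h. snd u \<le> h \<Longrightarrow> h \<le> snd v \<Longrightarrow> g h = f h" "snd u \<le> snd v"
  shows "chain_graph u v g"
  using assms continuous_on_cong[of "{snd u..snd v}" "{snd u..snd v}" g f]
  by (simp add: chain_graph_def)

lemma chain_graph_union:
  assumes f: "chain_graph u r f" "chain_graph r v f" and ord: "u \<sqsubseteq> r" "r \<sqsubseteq> v"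
    and [simp]: "u \<in> carrier H" "r \<in> carrier H" "v \<in> carrier H"
  shows "chain_graph u v f"
proof -
  have ur: "snd u \<le> snd r" "snd r \<le> snd v" using snd_mono ord by auto
  then have "continuous_on {snd u..snd v} f"
    using f continuous_on_closed_Un[of "{snd u..snd r}" "{snd r..snd v}" f]
    by (simp add: chain_graph_def ivl_disj_un_two_touch)
  moreover have "\<exists>p\<in>carrier H. \<exists>q\<in>carrier H. u \<sqsubseteq> p \<and> q \<sqsubseteq> v \<and> (p = q \<or> covers H p q) \<and>
      (f h, h) \<in> closed_segment p q" if h: "h \<in> {snd u..snd v}" for h
  proof (cases "h \<le> snd r")
    case True
    then have "h \<in> {snd u..snd r}" using h by simp
    then obtain p q where "p \<in> carrier H" "q \<in> carrier H" "u \<sqsubseteq> p" "q \<sqsubseteq> r" "p = q \<or> covers H p q"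
      "(f h, h) \<in> closed_segment p q"
      using f(1) unfolding chain_graph_def by blast
    then show ?thesis using ord le_trans[of q r v] assms(6,7) by blast
  next
    case False
    then have "h \<in> {snd r..snd v}" using h by simp
    then obtain p q where "p \<in> carrier H" "q \<in> carrier H" "r \<sqsubseteq> p" "q \<sqsubseteq> v" "p = q \<or> covers H p q"
      "(f h, h) \<in> closed_segment p q"
      using f(2) unfolding chain_graph_def by blast
    then show ?thesis using ord le_trans[of u r p] assms(5,6) by blast
  qed
  ultimately show ?thesis using f by (simp add: chain_graph_def)
qed

text \<open>The agreement with \<open>f\<close> up to height \<open>snd r\<close> is what later
  allows two chains to share their lower part.\<close>

lemma chain_graph_glue:
  assumes f: "chain_graph u r f" and g: "chain_graph r v g" and ord: "u \<sqsubseteq> r" "r \<sqsubseteq> v"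
    and [simp]: "u \<in> carrier H" "r \<in> carrier H" "v \<in> carrier H"
  shows "\<exists>F. chain_graph u r F \<and> chain_graph r v F \<and> (\<forall>h\<le>snd r. F h = f h)"
proof (intro exI conjI allI impI)
  have ur: "snd u \<le> snd r" "snd r \<le> snd v" using snd_mono ord by auto
  let ?F = "\<lambda>h. if h \<le> snd r then f h else g h"
  show "chain_graph u r ?F" using chain_graph_cong[OF f] ur by simp
  show "chain_graph r v ?F"
  proof (rule chain_graph_cong[OF g])
    show "?F h = g h" if "snd r \<le> h" for h
      using that f g by (auto simp: chain_graph_def dest: antisym)
  qed (use ur in auto)
qed simp

lemma chain_graph_exists: "u \<sqsubseteq> v \<Longrightarrow> u \<in> carrier H \<Longrightarrow> v \<in> carrier H \<Longrightarrow> \<exists>f. chain_graph u v f"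
proof (induction u v rule: interval_induct)
  case (refl u)
  then have "chain_graph u u (\<lambda>h. fst u)"
    by (auto simp: chain_graph_def intro!: bexI[of _ u])
  then show ?case by blast
next
  case (cover u v)
  note uv = coversD[OF cover]
  define t where "t h = (h - snd u) / (snd v - snd u)" for h
  define f where "f h = (1 - t h) * fst u + t h * fst v" for h
  have "(f h, h) \<in> closed_segment u v" if "h \<in> {snd u..snd v}" for h
  proof -
    have "0 \<le> t h" "t h \<le> 1" using that uv(4) by (auto simp: t_def)
    moreover have "h = (1 - t h) * snd u + t h * snd v"
    proof -
      have "t h * (snd v - snd u) = h - snd u" using uv(4) by (simp add: t_def)
      then show ?thesis by (simp add: algebra_simps)
    qed
    ultimately show ?thesis
      unfolding in_segment by (intro exI[of _ "t h"]) (auto simp: f_def prod_eq_iff)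
  qed
  moreover have "continuous_on {snd u..snd v} f"
    unfolding f_def t_def using uv(4) by (intro continuous_intros) auto
  moreover have "f (snd u) = fst u" "f (snd v) = fst v" using uv(4) by (auto simp: f_def t_def)
  ultimately have "chain_graph u v f" using cover uv unfolding chain_graph_def by blast
  then show ?case by blast
next
  case (split u r v)
  then obtain F where "chain_graph u r F" "chain_graph r v F"
    using chain_graph_glue[of u r _ v] by blast
  then show ?case using chain_graph_union split by blast
qed

text \<open>If the chains share a covering segment rather than a vertex at height \<open>h\<close>, then its upper end
  serves as \<open>w\<close>.\<close>

lemma chain_graphs_meet:
  assumes f: "chain_graph u v f" and g: "chain_graph u' v' g"
    and h: "h \<in> {snd u..snd v}" "h \<in> {snd u'..snd v'}" and eq: "f h = g h"
    and [simp]: "u \<in> carrier H" "v \<in> carrier H" "u' \<in> carrier H" "v' \<in> carrier H"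
  shows "\<exists>w\<in>carrier H. u \<sqsubseteq> w \<and> w \<sqsubseteq> v \<and> u' \<sqsubseteq> w \<and> w \<sqsubseteq> v' \<and> h \<le> snd w"
proof -
  obtain p q where pq: "p \<in> carrier H" "q \<in> carrier H" "u \<sqsubseteq> p" "q \<sqsubseteq> v" "p = q \<or> covers H p q"
    and z: "(f h, h) \<in> closed_segment p q"
    using f h(1) unfolding chain_graph_def by blast
  obtain r s where rs: "r \<in> carrier H" "s \<in> carrier H" "u' \<sqsubseteq> r" "s \<sqsubseteq> v'" "r = s \<or> covers H r s"
    and z': "(f h, h) \<in> closed_segment r s"
    using g h(2) eq unfolding chain_graph_def by metis
  have "p \<sqsubseteq> q" "r \<sqsubseteq> s" using pq(1,5) rs(1,5) coversD(3) by blast+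
  then have ord: "u \<sqsubseteq> q" "p \<sqsubseteq> v" "u' \<sqsubseteq> s" "r \<sqsubseteq> v'"
    using pq rs le_trans[of u p q] le_trans[of p q v] le_trans[of u' r s] le_trans[of r s v'] by auto
  have ends: "closed_segment p q \<inter> carrier H = {p, q}" "closed_segment r s \<inter> carrier H = {r, s}"
    using pq(1,5) rs(1,5) coversD(5)[of p q] coversD(5)[of r s] by auto
  have "\<exists>w. w \<in> {p, q} \<inter> {r, s} \<and> h \<le> snd w"
  proof (cases "closed_segment p q = closed_segment r s")
    case True
    have "snd p \<le> snd q" using pq coversD(4)[of p q] by auto
    then have "h \<le> snd q" using z closed_segment_PairD[of "f h" h "fst p" "snd p" "fst q" "snd q"]
      by (simp add: closed_segment_eq_real_ivl1)
    then show ?thesis using True ends by blast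
  next
    case False
    \<comment> \<open>Planarity speaks of coverings only. A degenerate segment is a vertex, and a
      vertex on the other segment is one of its ends.\<close>
    then have "(f h, h) \<in> {p, q} \<inter> {r, s}"
    proof (cases "p = q \<or> r = s")
      case True
      then have "(f h, h) \<in> carrier H" using z z' pq rs by auto
      then show ?thesis using z z' ends by blast
    next
      case False
      then show ?thesis
        using \<open>closed_segment p q \<noteq> closed_segment r s\<close> z z' pq(5) rs(5) planar
        unfolding planar_diagram_def by blast
    qed
    then show ?thesis by (intro exI[of _ "(f h, h)"]) simp
  qed
  then show ?thesis using pq(1-4) rs(1-4) ord by blast
qed

text \<open>The parts below and above \<open>b\<close> are kept apart, so that a meeting point of
  height at most \<open>snd b\<close> yields an element below \<open>b\<close>, and one of height at
  least \<open>snd b\<close> an element above it.\<close>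

definition through :: "real \<times> real \<Rightarrow> (real \<Rightarrow> real) \<Rightarrow> bool" where
  "through b F \<longleftrightarrow> chain_graph zero b F \<and> chain_graph b one F"

lemma through_exists: "b \<in> carrier H \<Longrightarrow> \<exists>F. through b F"
  using chain_graph_exists[of zero b] chain_graph_exists[of b one] zero one
    chain_graph_glue[of zero b _ one] unfolding through_def by blast

lemma through_at: "through b F \<Longrightarrow> F (snd b) = fst b"
  by (simp add: through_def chain_graph_def)

lemma through_total:
  assumes "through b F" "b \<in> carrier H"
  shows "chain_graph zero one F"
  using assms chain_graph_union[of zero b F one] zero one by (simp add: through_def)

section \<open>The left-of relation on incomparable pairs\<close>

abbreviation incomparable (infix "\<parallel>" 50) where
  "a \<parallel> b \<equiv> a \<in> carrier H \<and> b \<in> carrier H \<and> \<not> a \<sqsubseteq> b \<and> \<not> b \<sqsubseteq> a"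

lemma snd_bounds: "a \<in> carrier H \<Longrightarrow> snd zero \<le> snd a \<and> snd a \<le> snd one"
  using snd_mono zero one by blast

lemma through_continuous:
  assumes "through a F" "a \<in> carrier H" "b \<in> carrier H" "c \<in> carrier H"
  shows "continuous_on {snd b..snd c} F"
  using through_total[OF assms(1,2)] snd_bounds[OF assms(3)] snd_bounds[OF assms(4)]
  unfolding chain_graph_def by (auto elim: continuous_on_subset)

text \<open>Let \<open>a\<close> be the lower of the two points. If \<open>F\<close> and
  \<open>G\<close> met between the heights of \<open>a\<close> and \<open>b\<close>, the upper part
  of \<open>F\<close> and the lower part of \<open>G\<close> would share an element between
  \<open>a\<close> and \<open>b\<close>. So the sign of their difference is constant there.\<close>

lemma through_same_side:
  assumes ab: "a \<parallel> b" and F: "through a F" and G: "through b G"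
  shows "fst a < G (snd a) \<longleftrightarrow> F (snd b) < fst b" "fst a \<noteq> G (snd a)"
proof -
  have *: "F h \<noteq> G h"
    if asm: "a \<parallel> b" "through a F" "through b G" "h \<in> {snd a..snd b}" for a b F G h
  proof
    assume "F h = G h"
    moreover have "h \<in> {snd a..snd one}" "h \<in> {snd zero..snd b}"
      using asm(1,4) snd_bounds[of a] snd_bounds[of b] by auto
    ultimately obtain w where "w \<in> carrier H" "a \<sqsubseteq> w" "w \<sqsubseteq> b"
      using chain_graphs_meet[of a one F zero b G h] asm(1-3) zero(1) one(1) unfolding through_def by blast
    then show False using asm(1) le_trans[of a w b] by blast
  qed
  have **: "fst a < G (snd a) \<longleftrightarrow> F (snd b) < fst b" "fst a \<noteq> G (snd a)" "F (snd b) \<noteq> fst b"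
    if ab: "a \<parallel> b" "through a F" "through b G" "snd a \<le> snd b" for a b F G
  proof -
    note at = through_at[OF ab(2)] through_at[OF ab(3)]
    note no = *[OF ab(1-3)]
    show ne: "fst a \<noteq> G (snd a)" "F (snd b) \<noteq> fst b"
      using no[of "snd a"] no[of "snd b"] ab(4) at by auto
    have "continuous_on {snd a..snd b} F" "continuous_on {snd a..snd b} G"
      using ab through_continuous by blast+
    from graphs_cross[OF this ab(4)] no
    have "\<not> (F (snd a) < G (snd a) \<and> G (snd b) < F (snd b))"
      "\<not> (G (snd a) < F (snd a) \<and> F (snd b) < G (snd b))"
      by blast+
    then show "fst a < G (snd a) \<longleftrightarrow> F (snd b) < fst b" using ne at by linarith
  qed
  show "fst a < G (snd a) \<longleftrightarrow> F (snd b) < fst b" "fst a \<noteq> G (snd a)"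
  proof (atomize (full), cases "snd a \<le> snd b")
    case True
    then show "(fst a < G (snd a) \<longleftrightarrow> F (snd b) < fst b) \<and> fst a \<noteq> G (snd a)"
      using **[OF ab F G] by simp
  next
    case False
    then have "fst b < F (snd b) \<longleftrightarrow> G (snd a) < fst a" "fst b \<noteq> F (snd b)" "G (snd a) \<noteq> fst a"
      using **[OF _ G F] ab by simp_all
    then show "(fst a < G (snd a) \<longleftrightarrow> F (snd b) < fst b) \<and> fst a \<noteq> G (snd a)" by linarith
  qed
qed

definition left_of :: "real \<times> real \<Rightarrow> real \<times> real \<Rightarrow> bool" where
  "left_of a b \<longleftrightarrow> a \<parallel> b \<and> (\<exists>G. through b G \<and> fst a < G (snd a))"

text \<open>Each side of the equivalence in \<open>through_same_side\<close> mentions only one of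
  the two chains, hence its truth does not depend on the choice of either.\<close>

lemma left_of_iff:
  assumes "a \<parallel> b"
  shows "through b G \<Longrightarrow> left_of a b \<longleftrightarrow> fst a < G (snd a)"
    and "through a F \<Longrightarrow> left_of a b \<longleftrightarrow> F (snd b) < fst b"
proof -
  note side = through_same_side(1)[OF assms]
  have *: "left_of a b \<longleftrightarrow> F (snd b) < fst b" if F: "through a F" for F
  proof
    assume "left_of a b"
    then obtain G where "through b G" "fst a < G (snd a)" unfolding left_of_def by blast
    then show "F (snd b) < fst b" using side[OF F] by simp
  next
    assume "F (snd b) < fst b"
    moreover obtain G where "through b G" using assms through_exists[of b] by blast
    ultimately have "through b G \<and> fst a < G (snd a)" using side[OF F] by simp
    then show "left_of a b" using assms unfolding left_of_def by (intro conjI exI[of _ G]) auto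
  qed
  then show "through a F \<Longrightarrow> left_of a b \<longleftrightarrow> F (snd b) < fst b" .
  obtain F where "through a F" using assms through_exists[of a] by blast
  then show "left_of a b \<longleftrightarrow> fst a < G (snd a)" if "through b G" using * side that by simp
qed

lemma left_of_linear:
  assumes "a \<parallel> b"
  shows "left_of a b \<longleftrightarrow> \<not> left_of b a"
proof -
  obtain F G where FG: "through a F" "through b G" using assms through_exists[of a] through_exists[of b] by blast
  have "left_of a b \<longleftrightarrow> F (snd b) < fst b" by (rule left_of_iff(2)[OF assms FG(1)])
  moreover have "left_of b a \<longleftrightarrow> fst b < F (snd b)" by (rule left_of_iff(1)[OF _ FG(1)]) (use assms in simp)
  moreover have "fst b \<noteq> F (snd b)" by (rule through_same_side(2)[OF _ FG(2,1)]) (use assms in simp)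
  ultimately show ?thesis by auto
qed

text \<open>A common point not higher than \<open>b\<close> lies on the part of \<open>G\<close>
  below \<open>b\<close> and gives \<open>w\<close> with
  \<open>u \<sqsubseteq> w \<sqsubseteq> b\<close>; a higher one gives
  \<open>b \<sqsubseteq> w \<sqsubseteq> v\<close>.\<close>

lemma chain_through_comparable:
  assumes G: "through b G" "b \<in> carrier H" and F: "chain_graph u v F"
    and uv: "u \<in> carrier H" "v \<in> carrier H" and h: "h \<in> {snd u..snd v}" "F h = G h"
  shows "u \<sqsubseteq> b \<or> b \<sqsubseteq> v"
proof (cases "h \<le> snd b")
  case True
  then have "h \<in> {snd zero..snd b}" using h(1) snd_bounds[OF uv(1)] by auto
  then obtain w where "w \<in> carrier H" "u \<sqsubseteq> w" "w \<sqsubseteq> b"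
    using chain_graphs_meet[of u v F zero b G h] G F uv h zero(1) unfolding through_def by blast
  then show ?thesis using le_trans[of u w b] uv G by blast
next
  case False
  then have "h \<in> {snd b..snd one}" using h(1) snd_bounds[OF uv(2)] by auto
  then obtain w where "w \<in> carrier H" "b \<sqsubseteq> w" "w \<sqsubseteq> v"
    using chain_graphs_meet[of u v F b one G h] G F uv h one(1) unfolding through_def by blast
  then show ?thesis using le_trans[of b w v] uv G by blast
qed

text \<open>If \<open>a\<close> and \<open>c\<close> were comparable, a chain between them would
  have to cross a chain through \<open>b\<close>, since they lie on opposite sides of it. The
  crossing would make \<open>b\<close> comparable to \<open>a\<close> or \<open>c\<close>.\<close>

lemma left_of_incomparable:
  assumes ab: "left_of a b" and bc: "left_of b c"
  shows "a \<parallel> c"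
proof -
  have inc: "a \<parallel> b" "b \<parallel> c" using ab bc unfolding left_of_def by blast+
  obtain G where G: "through b G" using inc through_exists[of b] by blast
  have sides: "fst a < G (snd a)" "G (snd c) < fst c"
    using left_of_iff(1)[OF inc(1) G] left_of_iff(2)[OF inc(2) G] ab bc by auto
  have no: False
    if uv: "u \<sqsubseteq> v" "u \<in> carrier H" "v \<in> carrier H" "\<not> u \<sqsubseteq> b" "\<not> b \<sqsubseteq> v"
      and s: "fst u < G (snd u) \<and> G (snd v) < fst v \<or> G (snd u) < fst u \<and> fst v < G (snd v)" for u v
  proof -
    obtain F where F: "chain_graph u v F" using chain_graph_exists uv by blast
    have "F (snd u) = fst u" "F (snd v) = fst v" "continuous_on {snd u..snd v} F"
      using F by (simp_all add: chain_graph_def)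
    then obtain h where "h \<in> {snd u..snd v}" "F h = G h"
      using graphs_cross[of "snd u" "snd v" F G] s snd_mono[OF uv(1-3)] through_continuous[OF G _ uv(2,3)] inc
      by auto
    then show False using chain_through_comparable[OF G _ F] uv inc by blast
  qed
  then show ?thesis using no[of a c] no[of c a] sides inc by blast
qed

text \<open>Chains \<open>P\<close> through \<open>b\<close> and \<open>Q\<close> through
  \<open>c\<close> are chosen to coincide up to \<open>m\<close>. At the height of \<open>a\<close>
  the cycle puts \<open>Q\<close> left of \<open>P\<close>, while \<open>b\<close> being left of
  \<open>c\<close> reverses this higher up. The crossing in between yields a common lower bound of
  \<open>b\<close> and \<open>c\<close> that is higher than their meet.\<close>

lemma left_of_no_3_cycle:
  assumes ab: "left_of a b" and bc: "left_of b c" and ca: "left_of c a"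
    and lowest: "snd a \<le> snd b" "snd a \<le> snd c"
  shows False
proof -
  have inc: "a \<parallel> b" "b \<parallel> c" "c \<parallel> a" using ab bc ca unfolding left_of_def by blast+
  define m where "m = b \<sqinter> c"
  have m: "m \<in> carrier H" "m \<sqsubseteq> b" "m \<sqsubseteq> c" "\<And>w. w \<in> carrier H \<Longrightarrow> w \<sqsubseteq> b \<Longrightarrow> w \<sqsubseteq> c \<Longrightarrow> w \<sqsubseteq> m"
    using inc meet_left meet_right meet_le unfolding m_def by simp_all
  \<comment> \<open>Two gluings: \<open>K\<close> is prolonged from \<open>m\<close> to
    \<open>x\<close>, and the result from \<open>x\<close> to \<open>one\<close>. Neither changes
    anything up to \<open>m\<close>.\<close>
  have route: "\<exists>F. chain_graph m x F \<and> through x F \<and> (\<forall>h \<le> snd m. F h = K h)"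
    if K: "chain_graph zero m K" and x: "x \<in> carrier H" "m \<sqsubseteq> x" for x K
  proof -
    obtain f where "chain_graph m x f" using chain_graph_exists x m by blast
    then obtain F1 where F1: "chain_graph zero m F1" "chain_graph m x F1" "\<And>h. h \<le> snd m \<Longrightarrow> F1 h = K h"
      using chain_graph_glue[OF K, of x f] zero m x by blast
    then have "chain_graph zero x F1" using chain_graph_union[of zero m F1 x] zero m x by simp
    moreover obtain g where "chain_graph x one g" using chain_graph_exists x one by blast
    ultimately obtain F where F: "chain_graph zero x F" "chain_graph x one F" "\<And>h. h \<le> snd x \<Longrightarrow> F h = F1 h"
      using chain_graph_glue[of zero x F1 one g] zero one x by blast
    have mx: "snd m \<le> snd x" using snd_mono m x by blast
    then have "chain_graph m x F" using chain_graph_cong[OF F1(2), of F] F(3) by simp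
    moreover have "\<forall>h\<le>snd m. F h = K h" using F(3) F1(3) mx by simp
    ultimately show ?thesis using F(1,2) unfolding through_def by blast
  qed
  obtain K where K: "chain_graph zero m K" using chain_graph_exists[of zero m] zero m(1) by blast
  obtain P where P: "chain_graph m b P" "through b P" "\<And>h. h \<le> snd m \<Longrightarrow> P h = K h"
    using route[OF K, of b] m(2) inc(1) by blast
  obtain Q where Q: "chain_graph m c Q" "through c Q" "\<And>h. h \<le> snd m \<Longrightarrow> Q h = K h"
    using route[OF K, of c] m(3) inc(2) by blast
  have a: "fst a < P (snd a)" "Q (snd a) < fst a"
    using left_of_iff(1)[OF inc(1) P(2)] left_of_iff(2)[OF inc(3) Q(2)] ab ca by auto
  \<comment> \<open>Up to the height of \<open>m\<close> the chains agree, so \<open>a\<close> could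
    not lie strictly between them.\<close>
  have am: "snd m < snd a" using a P(3)[of "snd a"] Q(3)[of "snd a"] by (cases "snd a \<le> snd m") auto
  have bc': "P (snd c) < fst c" "fst b < Q (snd b)"
    using left_of_iff(2)[OF inc(2) P(2)] left_of_iff(1)[OF inc(2) Q(2)] bc by auto
  \<comment> \<open>At the lower of \<open>b\<close> and \<open>c\<close> both chains are still on
    their way up from \<open>m\<close>, so a crossing there gives an element below both. That
    \<open>a\<close> is lowest makes the range of heights from \<open>a\<close> to \<open>t\<close>
    nonempty.\<close>
  have "\<exists>t\<in>{b, c}. snd t \<le> snd b \<and> snd t \<le> snd c" by (cases "snd b \<le> snd c") simp_all
  then obtain t where t: "t \<in> {b, c}" "snd t \<le> snd b" "snd t \<le> snd c" by blast
  have "P (snd t) < Q (snd t)" using t bc' through_at[OF P(2)] through_at[OF Q(2)] by auto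
  moreover have "Q (snd a) < P (snd a)" using a by simp
  moreover have "continuous_on {snd a..snd t} P" "continuous_on {snd a..snd t} Q"
    using through_continuous[OF P(2), of a t] through_continuous[OF Q(2), of a t] inc t(1) by auto
  moreover have "snd a \<le> snd t" using lowest t by auto
  ultimately obtain h where h: "h \<in> {snd a..snd t}" "P h = Q h" using graphs_cross[of "snd a" "snd t" P Q] by blast
  moreover have "h \<in> {snd m..snd b}" "h \<in> {snd m..snd c}" using h am t by auto
  ultimately obtain w where "w \<in> carrier H" "w \<sqsubseteq> b" "w \<sqsubseteq> c" "h \<le> snd w"
    using chain_graphs_meet[OF P(1) Q(1), of h] m(1) inc by blast
  then show False using m(1) m(4)[of w] snd_mono[of w m] am h by auto
qed

text \<open>Incomparability leaves a 3-cycle as the only way to fail, and a cycle can be rotated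
  until its lowest element comes first.\<close>

lemma left_of_trans:
  assumes ab: "left_of a b" and bc: "left_of b c"
  shows "left_of a c"
proof (rule ccontr)
  assume "\<not> left_of a c"
  then have ca: "left_of c a" using left_of_linear[OF left_of_incomparable[OF ab bc]] by simp
  consider "snd a \<le> snd b" "snd a \<le> snd c" | "snd b \<le> snd a" "snd b \<le> snd c"
    | "snd c \<le> snd a" "snd c \<le> snd b" by linarith
  then show False
    using left_of_no_3_cycle[OF ab bc ca] left_of_no_3_cycle[OF bc ca ab] left_of_no_3_cycle[OF ca ab bc]
    by cases auto
qed

section \<open>Two linear extensions that determine the order\<close>

lemma linear_extension_of_conjugate:
  assumes inc: "\<And>a b. S a b \<Longrightarrow> a \<parallel> b" and lin: "\<And>a b. a \<parallel> b \<Longrightarrow> S a b \<longleftrightarrow> \<not> S b a"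
    and tr: "\<And>a b c. S a b \<Longrightarrow> S b c \<Longrightarrow> S a c"
  shows "\<exists>X :: real \<times> real \<Rightarrow> real. \<forall>a\<in>carrier H. \<forall>b\<in>carrier H. a \<sqsubseteq> b \<or> S a b \<longleftrightarrow> X a \<le> X b"
proof (rule linear_extension_rank[OF finite_carrier])
  show "(a \<sqsubseteq> b \<or> S a b) \<or> (b \<sqsubseteq> a \<or> S b a)" if "a \<in> carrier H" "b \<in> carrier H" for a b
    using that lin[of a b] by blast
  fix a b c
  assume [simp]: "a \<in> carrier H" "b \<in> carrier H" "c \<in> carrier H"
    and ab: "a \<sqsubseteq> b \<or> S a b" and bc: "b \<sqsubseteq> c \<or> S b c"
  show "a \<sqsubseteq> c \<or> S a c"
  proof (rule ccontr)
    assume "\<not> (a \<sqsubseteq> c \<or> S a c)"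
    \<comment> \<open>This closes a cycle. Two cyclically consecutive steps are of the same kind and
      compose. The result contradicts \<open>nac\<close>, or reverses the third step; in the latter
      case mixed kinds clash with incomparability, and three equal kinds lead back to
      \<open>nac\<close>.\<close>
    then have "c \<sqsubseteq> a \<or> S c a" and nac: "\<not> a \<sqsubseteq> c" "\<not> S a c" using lin[of a c] by auto
    then show False
      using ab bc tr[of a b c] tr[of b c a] tr[of c a b] inc[of a b] inc[of b c] inc[of b a] inc[of c b]
        le_trans[of a b c] le_trans[of b c a] le_trans[of c a b] by auto
  qed
qed

lemma two_dimensional: "two_dimensional H"
proof -
  have inc: "a \<parallel> b" if "left_of a b" for a b using that unfolding left_of_def by blast
  have inc': "a \<parallel> b" if "left_of b a" for a b using inc[OF that] by blast
  have lin': "left_of b a \<longleftrightarrow> \<not> left_of a b" if "a \<parallel> b" for a b using left_of_linear[OF that] by blast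
  have "\<exists>X :: real \<times> real \<Rightarrow> real. \<forall>a\<in>carrier H. \<forall>b\<in>carrier H. a \<sqsubseteq> b \<or> left_of a b \<longleftrightarrow> X a \<le> X b"
    by (rule linear_extension_of_conjugate[of left_of]) (rule inc left_of_linear left_of_trans; assumption)+
  then obtain X :: "real \<times> real \<Rightarrow> real"
    where X: "\<And>a b. a \<in> carrier H \<Longrightarrow> b \<in> carrier H \<Longrightarrow> a \<sqsubseteq> b \<or> left_of a b \<longleftrightarrow> X a \<le> X b"
    by blast
  have "\<exists>Y :: real \<times> real \<Rightarrow> real. \<forall>a\<in>carrier H. \<forall>b\<in>carrier H. a \<sqsubseteq> b \<or> left_of b a \<longleftrightarrow> Y a \<le> Y b"
    by (rule linear_extension_of_conjugate[of "\<lambda>a b. left_of b a"])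
       (rule inc' lin' left_of_trans; assumption)+
  then obtain Y :: "real \<times> real \<Rightarrow> real"
    where Y: "\<And>a b. a \<in> carrier H \<Longrightarrow> b \<in> carrier H \<Longrightarrow> a \<sqsubseteq> b \<or> left_of b a \<longleftrightarrow> Y a \<le> Y b"
    by blast
  have "a = b" if ab: "a \<in> carrier H" "b \<in> carrier H" "Y a = Y b" for a b
  proof -
    \<comment> \<open>Equal ranks give both directions of the extension; \<open>left_of\<close>
      cannot supply both, nor one of them next to a comparability.\<close>
    have "a \<sqsubseteq> b \<or> left_of b a" "b \<sqsubseteq> a \<or> left_of a b"
      using Y[OF ab(1,2)] Y[OF ab(2,1)] ab(3) by simp_all
    then have "a \<sqsubseteq> b" "b \<sqsubseteq> a" using inc[of a b] inc[of b a] left_of_linear[of a b] by blast+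
    then show ?thesis using antisymmetric ab(1,2) by simp
  qed
  then have "inj_on Y (carrier H)" by (rule inj_onI)
  moreover have "a \<sqsubseteq> b \<longleftrightarrow> X a \<le> X b \<and> Y a \<le> Y b" if ab: "a \<in> carrier H" "b \<in> carrier H" for a b
    unfolding X[OF ab, symmetric] Y[OF ab, symmetric]
    using inc[of a b] inc[of b a] left_of_linear[of a b] by blast
  ultimately show ?thesis unfolding two_dimensional_def by blast
qed

end

section \<open>Planar lattices and their quotients\<close>

lemma planar_lattice_two_dimensional:
  assumes "planar_lattice L"
  shows "two_dimensional L" "finite (carrier L)"
proof -
  obtain H :: "(real \<times> real) gorder" and f where H: "planar_lattice_diagram H" and f: "lattice_iso L H f"
    using assms unfolding planar_lattice_def by blast
  have bij: "bij_betw f (carrier L) (carrier H)" using f by (simp add: lattice_iso_def)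
  have fin: "finite (carrier H)" and lat: "lattice H"
    using H by (simp_all add: planar_lattice_diagram_def planar_diagram_def diagram_def)
  show "finite (carrier L)" using bij fin bij_betw_finite by blast
  interpret lattice H by (rule lat)
  have "two_dimensional H"
  \<comment> \<open>A lattice may be empty here and then has no bounds to instantiate the locale
    with.\<close>
  proof (cases "carrier H = {}")
    case True
    then show ?thesis by (simp add: two_dimensional_def)
  next
    case False
    have "greatest H (\<Sqinter>\<^bsub>H\<^esub>carrier H) (Lower H (carrier H))" "least H (\<Squnion>\<^bsub>H\<^esub>carrier H) (Upper H (carrier H))"
      using fin False finite_inf_greatest finite_sup_least by blast+
    note bounds = this[unfolded greatest_def least_def Lower_def Upper_def]
    interpret bounded_planar_diagram H "\<Sqinter>\<^bsub>H\<^esub>carrier H" "\<Squnion>\<^bsub>H\<^esub>carrier H"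
    proof
      show "planar_diagram H" using H by (simp add: planar_lattice_diagram_def)
    qed (use bounds in blast)+
    show ?thesis by (rule two_dimensional)
  qed
  moreover have "inj_on f (carrier L)" "f \<in> carrier L \<rightarrow> carrier H" using bij by (auto simp: bij_betw_def)
  ultimately show "two_dimensional L"
    using two_dimensional_embedding[of H f L] lattice_iso_le_iff[OF f] by blast
qed

theorem corollary26:
  fixes L :: "('a, 'm) gorder_scheme" and \<gamma> :: "('a \<times> 'a) set"
  assumes "planar_lattice L"
    and "lattice_congruence L \<gamma>"
  shows "planar_lattice (quotient_lattice L \<gamma>)"
proof (rule planar_lattice_of_two_dimensional)
  let ?Q = "quotient_lattice L \<gamma>"
  have lat: "lattice L" using assms(1) by (simp add: planar_lattice_def)
  interpret lattice L by (rule lat)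
  note cong = lat assms(2)
  note dim = planar_lattice_two_dimensional[OF assms(1)]
  show "lattice ?Q" by (rule lattice_quotient_lattice[OF cong])
  show "finite (carrier ?Q)"
    using finite_quotient[OF dim(2)] congruence_equiv[OF cong] by (simp add: equiv_type)
  obtain X Y :: "'a \<Rightarrow> real" where Y: "inj_on Y (carrier L)"
    and XY: "\<And>a b. a \<in> carrier L \<Longrightarrow> b \<in> carrier L \<Longrightarrow> a \<sqsubseteq>\<^bsub>L\<^esub> b \<longleftrightarrow> X a \<le> X b \<and> Y a \<le> Y b"
    using dim(1) unfolding two_dimensional_def by blast
  \<comment> \<open>A class is finite and closed under meets. A member \<open>m\<close> with minimal
    \<open>Y\<close> is least: \<open>Y\<close> is monotone, so \<open>m \<sqinter> x\<close> has
    the same \<open>Y\<close> as \<open>m\<close>, and \<open>Y\<close> is injective.\<close>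
  have "\<exists>m\<in>carrier L. A = \<gamma> `` {m} \<and> (\<forall>x. (m, x) \<in> \<gamma> \<longrightarrow> m \<sqsubseteq>\<^bsub>L\<^esub> x)" if A: "A \<in> carrier ?Q" for A
  proof -
    obtain a where a: "a \<in> carrier L" "A = \<gamma> `` {a}" using A by (auto elim: quotientE)
    have sub: "A \<subseteq> carrier L" using a(2) equiv_type[OF congruence_equiv[OF cong]] by auto
    then have "finite A" "A \<noteq> {}"
      using dim(2) finite_subset a congruence_refl[OF cong, of a] by auto
    then obtain m where m: "m \<in> A" "\<And>x. x \<in> A \<Longrightarrow> Y m \<le> Y x"
      using arg_min_if_finite[of A Y] by (meson not_less)
    then have mL: "m \<in> carrier L" and Am: "A = \<gamma> `` {m}"
      using sub a congruence_class_eq[OF cong, of a m] by auto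
    have "m \<sqsubseteq>\<^bsub>L\<^esub> x" if x: "(m, x) \<in> \<gamma>" for x
    proof -
      have xL: "x \<in> carrier L" using x Am sub by blast
      have "(m \<sqinter>\<^bsub>L\<^esub> m, m \<sqinter>\<^bsub>L\<^esub> x) \<in> \<gamma>"
        by (rule congruence_meet[OF cong congruence_refl[OF cong mL] x])
      moreover have "m \<sqinter>\<^bsub>L\<^esub> m = m" using le_iff_join[of m m] mL by simp
      ultimately have "Y m \<le> Y (m \<sqinter>\<^bsub>L\<^esub> x)" using m(2) Am by simp
      moreover have "Y (m \<sqinter>\<^bsub>L\<^esub> x) \<le> Y m" using XY[of "m \<sqinter>\<^bsub>L\<^esub> x" m] mL xL meet_left by simp
      ultimately have "m = m \<sqinter>\<^bsub>L\<^esub> x" using Y mL xL by (simp add: inj_on_def)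
      then show ?thesis using le_iff_join mL xL by simp
    qed
    then show ?thesis using mL Am by blast
  qed
  then obtain e where e: "\<And>A. A \<in> carrier ?Q \<Longrightarrow> e A \<in> carrier L"
    "\<And>A. A \<in> carrier ?Q \<Longrightarrow> A = \<gamma> `` {e A}"
    "\<And>A x. A \<in> carrier ?Q \<Longrightarrow> (e A, x) \<in> \<gamma> \<Longrightarrow> e A \<sqsubseteq>\<^bsub>L\<^esub> x"
    by metis
  show "two_dimensional ?Q"
  proof (rule two_dimensional_embedding[OF dim(1)])
    show "inj_on e (carrier ?Q)" using e(2) by (metis inj_onI)
    show "e \<in> carrier ?Q \<rightarrow> carrier L" using e(1) by blast
    fix A B assume AB: "A \<in> carrier ?Q" "B \<in> carrier ?Q"
    note eA = e(1)[OF AB(1)] and eB = e(1)[OF AB(2)]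
    have iff: "A \<sqsubseteq>\<^bsub>?Q\<^esub> B \<longleftrightarrow> (e A \<sqinter>\<^bsub>L\<^esub> e B, e A) \<in> \<gamma>"
      using quotient_lattice_le_meet[OF cong eA eB] e(2)[OF AB(1)] e(2)[OF AB(2)] by simp
    show "A \<sqsubseteq>\<^bsub>?Q\<^esub> B \<longleftrightarrow> e A \<sqsubseteq>\<^bsub>L\<^esub> e B"
    proof
      \<comment> \<open>By \<open>iff\<close> the meet of \<open>e A\<close> and \<open>e B\<close>
        lies in the class \<open>A\<close>, whose least element is \<open>e A\<close>.\<close>
      assume "A \<sqsubseteq>\<^bsub>?Q\<^esub> B"
      then have "e A \<sqsubseteq>\<^bsub>L\<^esub> e A \<sqinter>\<^bsub>L\<^esub> e B" using iff e(3)[OF AB(1)] congruence_sym[OF cong] by blast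
      then show "e A \<sqsubseteq>\<^bsub>L\<^esub> e B"
        using le_trans[of "e A" "e A \<sqinter>\<^bsub>L\<^esub> e B" "e B"] meet_right[of "e A" "e B"] eA eB by simp
    next
      assume "e A \<sqsubseteq>\<^bsub>L\<^esub> e B"
      then have "e A \<sqinter>\<^bsub>L\<^esub> e B = e A" using le_iff_join[of "e A" "e B"] eA eB by simp
      then show "A \<sqsubseteq>\<^bsub>?Q\<^esub> B" using iff congruence_refl[OF cong eA] by simp
    qed
  qed
qed

end
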